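(* Let $A$ be an $N\times N$ symmetric positive definite matrix, let $q\ge 1$, and let the index sets $\mathcal I^{(k)},\mathcal J^{(k)}$, the matrices $\pi^{(k,k+1)},\pi^{(k,q)},\pi^{(q,k)},W^{(k)}$ and the subspaces $\mathfrak V^{(1)},\mathfrak W^{(2)},\dots,\mathfrak W^{(q)}$ of $\mathbb R^N$ be as in the context. Assume that there exist constants $C_{\mathfrak d}\ge 1$ and $H\in(0,1)$ such that (i) $\displaystyle \frac{1}{C_{\mathfrak d}\sqrt{\lambda_{\min}(A)}}H^k\le \inf_{0\neq x\in \operatorname{Im}(\pi^{(q,k)})}\frac{\sqrt{x^TA^{-1}x}}{|x|}$ for $k\in\{1,\dots,q\}$, and (ii) $\displaystyle \sup_{0\ne x\in\operatorname{Ker}(\pi^{(k,q)})}\frac{\sqrt{x^TA^{-1}x}}{|x|}\le \frac{C_{\mathfrak d}}{\sqrt{\lambda_{\min}(A)}}H^k$ for $k\in\{1,\dots,q-1\}$. Then there exists a constant $C\ge 1$ depending only on $C_{\mathfrak d}$ such that $$C^{-1}H^2\le \lambda_{\min}(A)\frac{v^TAv}{|Av|^2}\le C\qquad\text{for all nonzero } v\in\mathfrak V^{(1)},$$ and, for $k\in\{2,\dots,q\}$, $$C^{-1}H^{2k}\le \lambda_{\min}(A)\frac{v^TAv}{|Av|^2}\le C H^{2k-2}\qquad\text{for all nonzero } v\in\mathfrak W^{(k)}.$$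
   Context: $|\cdot|$ is the Euclidean norm and $\lambda_{\min}$ the smallest eigenvalue. Index tree: $\mathcal I^{(q)}$ is a finite set of $q$-tuples $i=(i_1,\dots,i_q)$ with $N$ elements, used to relabel $\{1,\dots,N\}$ (so $\mathbb R^N=\mathbb R^{\mathcal I^{(q)}}$ with canonical basis $(e_i)_{i\in\mathcal I^{(q)}}$). For a tuple $i$ of length $\geq k$, $i^{(k)}:=(i_1,\dots,i_k)$, and $\mathcal I^{(k)}:=\{i^{(k)}: i\in\mathcal I^{(q)}\}$. $I^{(k)}$ is the $\mathcal I^{(k)}\times\mathcal I^{(k)}$ identity matrix. For $k\in\{1,\dots,q-1\}$, $\pi^{(k,k+1)}$ is an $\mathcal I^{(k)}\times\mathcal I^{(k+1)}$ matrix with $\pi^{(k,k+1)}(\pi^{(k,k+1)})^T=I^{(k)}$; $\pi^{(k,q)}:=\pi^{(k,k+1)}\pi^{(k+1,k+2)}\cdots\pi^{(q-1,q)}$, $\pi^{(q,q)}:=I^{(q)}$, and $\pi^{(q,k)}:=(\pi^{(k,q)})^T$. For $k\in\{2,\dots,q\}$, $\mathcal J^{(k)}$ is a finite set of $k$-tuples with $\{j^{(k-1)}:j\in\mathcal J^{(k)}\}=\mathcal I^{(k-1)}$ and, for each $i\in\mathcal I^{(k-1)}$, $\#\{j\in\mathcal J^{(k)}:j^{(k-1)}=i\}=\#\{s\in\mathcal I^{(k)}:s^{(k-1)}=i\}-1$. $J^{(k)}$ is the $\mathcal J^{(k)}\times\mathcal J^{(k)}$ identity. $W^{(k)}$ is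 a $\mathcal J^{(k)}\times\mathcal I^{(k)}$ matrix with $\operatorname{Im}(W^{(k),T})=\operatorname{Ker}(\pi^{(k-1,k)})$ and $W^{(k)}W^{(k),T}=J^{(k)}$. Exact gamblet transform: set $A^{(q)}=A$, $\psi^{(q)}_i=e_i$. For $k=q,q-1,\dots,2$: $B^{(k)}=W^{(k)}A^{(k)}W^{(k),T}$; $\chi^{(k)}_i=\sum_{j\in\mathcal I^{(k)}}W^{(k)}_{i,j}\psi^{(k)}_j$ for $i\in\mathcal J^{(k)}$; $N^{(k)}=A^{(k)}W^{(k),T}(B^{(k)})^{-1}$; $R^{(k-1,k)}=\pi^{(k-1,k)}(I^{(k)}-N^{(k)}W^{(k)})$; $A^{(k-1)}=R^{(k-1,k)}A^{(k)}(R^{(k-1,k)})^T$; $\psi^{(k-1)}_i=\sum_{j\in\mathcal I^{(k)}}R^{(k-1,k)}_{i,j}\psi^{(k)}_j$ for $i\in\mathcal I^{(k-1)}$. $\mathfrak V^{(k)}:=\operatorname{span}\{\psi^{(k)}_i: i\in\mathcal I^{(k)}\}$ and $\mathfrak W^{(k)}:=\operatorname{span}\{\chi^{(k)}_i:i\in\mathcal J^{(k)}\}$. *)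

theory Defs
  imports "HOL-Analysis.Analysis"
begin

text \<open>Tuples are lists of naturals. A vector of \<open>\<real>\<^sup>S\<close>, for a finite set \<open>S\<close> of tuples, is a function
  vanishing outside \<open>S\<close>; an \<open>S \<times> T\<close> matrix is a function of two tuples vanishing outside
  \<open>S \<times> T\<close>. The index sets that are summed over are passed explicitly. The Euclidean norm of
  \<open>x\<close> in \<open>\<real>\<^sup>S\<close> is the library's \<open>L2_set x S\<close>.\<close>

type_synonym tuple = "nat list"
type_synonym tvec = "tuple \<Rightarrow> real"
type_synonym tmat = "tuple \<Rightarrow> tuple \<Rightarrow> real"

definition vecs :: "tuple set \<Rightarrow> tvec set" where
  "vecs S = {x. \<forall>i. i \<notin> S \<longrightarrow> x i = 0}"

definition mats :: "tuple set \<Rightarrow> tuple set \<Rightarrow> tmat set" where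
  "mats S T = {M. \<forall>i j. \<not> (i \<in> S \<and> j \<in> T) \<longrightarrow> M i j = 0}"

definition zerov :: tvec where
  "zerov = (\<lambda>_. 0)"

definition unitv :: "tuple \<Rightarrow> tvec" where
  "unitv i = (\<lambda>x. if x = i then 1 else 0)"

definition dotp :: "tuple set \<Rightarrow> tvec \<Rightarrow> tvec \<Rightarrow> real" where
  "dotp S x y = (\<Sum>i\<in>S. x i * y i)"

definition idm :: "tuple set \<Rightarrow> tmat" where
  "idm S = (\<lambda>i j. if i = j \<and> i \<in> S then 1 else 0)"

definition transp :: "tmat \<Rightarrow> tmat" where
  "transp M = (\<lambda>i j. M j i)"

definition subm :: "tmat \<Rightarrow> tmat \<Rightarrow> tmat" where
  "subm M M' = (\<lambda>i j. M i j - M' i j)"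

text \<open>In \<open>mmul T\<close> and \<open>mapp T\<close> the set \<open>T\<close> is the contracted index set.\<close>

definition mmul :: "tuple set \<Rightarrow> tmat \<Rightarrow> tmat \<Rightarrow> tmat" where
  "mmul T M M' = (\<lambda>i j. \<Sum>t\<in>T. M i t * M' t j)"

definition mapp :: "tuple set \<Rightarrow> tmat \<Rightarrow> tvec \<Rightarrow> tvec" where
  "mapp T M x = (\<lambda>i. \<Sum>t\<in>T. M i t * x t)"

definition image_of :: "tuple set \<Rightarrow> tmat \<Rightarrow> tvec set" where
  "image_of T M = mapp T M ` vecs T"

definition kernel_of :: "tuple set \<Rightarrow> tmat \<Rightarrow> tvec set" where
  "kernel_of T M = {x \<in> vecs T. mapp T M x = zerov}"

text \<open>Unspecified when \<open>M\<close> is not an invertible \<open>S \<times> S\<close> matrix.\<close>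

definition minv :: "tuple set \<Rightarrow> tmat \<Rightarrow> tmat" where
  "minv S M = (THE M'. M' \<in> mats S S \<and> mmul S M M' = idm S \<and> mmul S M' M = idm S)"

definition symmetric_mat :: "tmat \<Rightarrow> bool" where
  "symmetric_mat M \<longleftrightarrow> transp M = M"

definition posdef_mat :: "tuple set \<Rightarrow> tmat \<Rightarrow> bool" where
  "posdef_mat S M \<longleftrightarrow> (\<forall>x\<in>vecs S. x \<noteq> zerov \<longrightarrow> dotp S x (mapp S M x) > 0)"

definition is_eigenvalue :: "tuple set \<Rightarrow> tmat \<Rightarrow> real \<Rightarrow> bool" where
  "is_eigenvalue S M l \<longleftrightarrow> (\<exists>v\<in>vecs S. v \<noteq> zerov \<and> mapp S M v = (\<lambda>i. l * v i))"

definition lambda_min :: "tuple set \<Rightarrow> tmat \<Rightarrow> real" where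
  "lambda_min S M = (LEAST l. is_eigenvalue S M l)"

definition span_of :: "tuple set \<Rightarrow> (tuple \<Rightarrow> tvec) \<Rightarrow> tvec set" where
  "span_of S f = {v. \<exists>c. v = (\<lambda>x. \<Sum>i\<in>S. c i * f i x)}"

text \<open>\<open>level I k\<close> is \<open>\<I>\<^bsup>(k)\<^esup>\<close>, where \<open>I = \<I>\<^bsup>(q)\<^esup>\<close>.\<close>

definition level :: "tuple set \<Rightarrow> nat \<Rightarrow> tuple set" where
  "level I k = take k ` I"

definition index_tree :: "nat \<Rightarrow> tuple set \<Rightarrow> bool" where
  "index_tree q I \<longleftrightarrow> q \<ge> 1 \<and> finite I \<and> I \<noteq> {} \<and> (\<forall>i\<in>I. length i = q)"

text \<open>\<open>p k\<close> is \<open>\<pi>\<^bsup>(k,k+1)\<^esup>\<close>.\<close>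

definition pi_family :: "nat \<Rightarrow> tuple set \<Rightarrow> (nat \<Rightarrow> tmat) \<Rightarrow> bool" where
  "pi_family q I p \<longleftrightarrow> (\<forall>k\<in>{1..<q}.
     p k \<in> mats (level I k) (level I (k+1)) \<and>
     mmul (level I (k+1)) (p k) (transp (p k)) = idm (level I k))"

text \<open>\<open>pi_to_q q I p k\<close> is \<open>\<pi>\<^bsup>(k,q)\<^esup>\<close>.\<close>

function pi_to_q :: "nat \<Rightarrow> tuple set \<Rightarrow> (nat \<Rightarrow> tmat) \<Rightarrow> nat \<Rightarrow> tmat" where
  "pi_to_q q I p k =
     (if k \<ge> q then idm I else mmul (level I (k+1)) (p k) (pi_to_q q I p (k+1)))"
  by pat_completeness auto
termination by (relation "Wellfounded.measure (\<lambda>(q, I, p, k). q - k)") auto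

declare pi_to_q.simps [simp del]

definition pi_from_q :: "nat \<Rightarrow> tuple set \<Rightarrow> (nat \<Rightarrow> tmat) \<Rightarrow> nat \<Rightarrow> tmat" where
  "pi_from_q q I p k = transp (pi_to_q q I p k)"

definition J_family :: "nat \<Rightarrow> tuple set \<Rightarrow> (nat \<Rightarrow> tuple set) \<Rightarrow> bool" where
  "J_family q I J \<longleftrightarrow> (\<forall>k\<in>{2..q}.
     finite (J k) \<and> (\<forall>j\<in>J k. length j = k) \<and>
     take (k-1) ` J k = level I (k-1) \<and>
     (\<forall>i\<in>level I (k-1).
        card {j \<in> J k. take (k-1) j = i} = card {s \<in> level I k. take (k-1) s = i} - 1))"

definition W_family ::
  "nat \<Rightarrow> tuple set \<Rightarrow> (nat \<Rightarrow> tuple set) \<Rightarrow> (nat \<Rightarrow> tmat) \<Rightarrow> (nat \<Rightarrow> tmat) \<Rightarrow> bool" where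
  "W_family q I J p W \<longleftrightarrow> (\<forall>k\<in>{2..q}.
     W k \<in> mats (J k) (level I k) \<and>
     image_of (J k) (transp (W k)) = kernel_of (level I k) (p (k-1)) \<and>
     mmul (level I k) (W k) (transp (W k)) = idm (J k))"

text \<open>One step of the transform, from level \<open>k\<close> to level \<open>k-1\<close>: here \<open>S = \<I>\<^bsup>(k)\<^esup>\<close>,
  \<open>T = \<J>\<^bsup>(k)\<^esup>\<close>, \<open>w = W\<^bsup>(k)\<^esup>\<close>, \<open>P = \<pi>\<^bsup>(k-1,k)\<^esup>\<close> and \<open>M = A\<^bsup>(k)\<^esup>\<close>.\<close>

definition step_B :: "tuple set \<Rightarrow> tmat \<Rightarrow> tmat \<Rightarrow> tmat" where
  "step_B S w M = mmul S (mmul S w M) (transp w)"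

definition step_N :: "tuple set \<Rightarrow> tuple set \<Rightarrow> tmat \<Rightarrow> tmat \<Rightarrow> tmat" where
  "step_N S T w M = mmul T (mmul S M (transp w)) (minv T (step_B S w M))"

definition step_R :: "tuple set \<Rightarrow> tuple set \<Rightarrow> tmat \<Rightarrow> tmat \<Rightarrow> tmat \<Rightarrow> tmat" where
  "step_R S T P w M = mmul S P (subm (idm S) (mmul T (step_N S T w M) w))"

definition step_A :: "tuple set \<Rightarrow> tuple set \<Rightarrow> tmat \<Rightarrow> tmat \<Rightarrow> tmat \<Rightarrow> tmat" where
  "step_A S T P w M =
     mmul S (mmul S (step_R S T P w M) M) (transp (step_R S T P w M))"

text \<open>\<open>gamblet_A \<dots> k\<close> is \<open>A\<^bsup>(k)\<^esup>\<close> and \<open>gamblet_psi \<dots> k i\<close> is \<open>\<psi>\<^bsup>(k)\<^esup>\<^sub>i\<close>, by recursion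
  from level \<open>k+1\<close> down to level \<open>k\<close>; \<open>gamblet_R \<dots> k\<close> is \<open>R\<^bsup>(k,k+1)\<^esup>\<close>.\<close>

function gamblet_A :: "nat \<Rightarrow> tuple set \<Rightarrow> (nat \<Rightarrow> tuple set) \<Rightarrow> (nat \<Rightarrow> tmat) \<Rightarrow> (nat \<Rightarrow> tmat)
    \<Rightarrow> tmat \<Rightarrow> nat \<Rightarrow> tmat" where
  "gamblet_A q I J p W A k =
     (if k \<ge> q then A
      else step_A (level I (k+1)) (J (k+1)) (p k) (W (k+1)) (gamblet_A q I J p W A (k+1)))"
  by pat_completeness auto
termination by (relation "Wellfounded.measure (\<lambda>(q, I, J, p, W, A, k). q - k)") auto

declare gamblet_A.simps [simp del]

definition gamblet_R :: "nat \<Rightarrow> tuple set \<Rightarrow> (nat \<Rightarrow> tuple set) \<Rightarrow> (nat \<Rightarrow> tmat) \<Rightarrow> (nat \<Rightarrow> tmat)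
    \<Rightarrow> tmat \<Rightarrow> nat \<Rightarrow> tmat" where
  "gamblet_R q I J p W A k =
     step_R (level I (k+1)) (J (k+1)) (p k) (W (k+1)) (gamblet_A q I J p W A (k+1))"

function gamblet_psi :: "nat \<Rightarrow> tuple set \<Rightarrow> (nat \<Rightarrow> tuple set) \<Rightarrow> (nat \<Rightarrow> tmat) \<Rightarrow> (nat \<Rightarrow> tmat)
    \<Rightarrow> tmat \<Rightarrow> nat \<Rightarrow> tuple \<Rightarrow> tvec" where
  "gamblet_psi q I J p W A k i =
     (if k \<ge> q then unitv i
      else (\<lambda>x. \<Sum>j\<in>level I (k+1). gamblet_R q I J p W A k i j * gamblet_psi q I J p W A (k+1) j x))"
  by pat_completeness auto
termination by (relation "Wellfounded.measure (\<lambda>(q, I, J, p, W, A, k, i). q - k)") auto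

declare gamblet_psi.simps [simp del]

definition gamblet_chi :: "nat \<Rightarrow> tuple set \<Rightarrow> (nat \<Rightarrow> tuple set) \<Rightarrow> (nat \<Rightarrow> tmat) \<Rightarrow> (nat \<Rightarrow> tmat)
    \<Rightarrow> tmat \<Rightarrow> nat \<Rightarrow> tuple \<Rightarrow> tvec" where
  "gamblet_chi q I J p W A k i = (\<lambda>x. \<Sum>j\<in>level I k. W k i j * gamblet_psi q I J p W A k j x)"

definition V_space :: "nat \<Rightarrow> tuple set \<Rightarrow> (nat \<Rightarrow> tuple set) \<Rightarrow> (nat \<Rightarrow> tmat) \<Rightarrow> (nat \<Rightarrow> tmat)
    \<Rightarrow> tmat \<Rightarrow> nat \<Rightarrow> tvec set" where
  "V_space q I J p W A k = span_of (level I k) (gamblet_psi q I J p W A k)"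

definition W_space :: "nat \<Rightarrow> tuple set \<Rightarrow> (nat \<Rightarrow> tuple set) \<Rightarrow> (nat \<Rightarrow> tmat) \<Rightarrow> (nat \<Rightarrow> tmat)
    \<Rightarrow> tmat \<Rightarrow> nat \<Rightarrow> tvec set" where
  "W_space q I J p W A k = span_of (J k) (gamblet_chi q I J p W A k)"

end

theory Submission imports Defs begin

text \<open>Put \<open>x = A v\<close>, so that the quotient is \<open>x\<^sup>T A\<^sup>-\<^sup>1 x / \<bar>x\<bar>\<^sup>2\<close>. The transform satisfies
  \<open>\<Psi>\<^bsup>(k)\<^esup> \<pi>\<^bsup>(q,k)\<^esup> = I\<^bsup>(k)\<^esup>\<close> and \<open>A \<Psi>\<^bsup>(k),T\<^esup> = \<pi>\<^bsup>(q,k)\<^esup> A\<^bsup>(k)\<^esup>\<close>, where the rows of \<open>\<Psi>\<^bsup>(k)\<^esup>\<close> are the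
  \<open>\<psi>\<^bsup>(k)\<^esup>\<^sub>i\<close>. Hence \<open>A\<close> maps \<open>\<V>\<^bsup>(k)\<^esup>\<close> into \<open>Im \<pi>\<^bsup>(q,k)\<^esup>\<close>, and (i) at \<open>x\<close> is the lower bound; moreover
  \<open>\<W>\<^bsup>(k)\<^esup> \<subseteq> Ker \<pi>\<^bsup>(k-1,q)\<^esup>\<close>. For \<open>v \<in> Ker \<pi>\<^bsup>(k-1,q)\<^esup>\<close>, let \<open>y\<close> be the orthogonal projection of \<open>x\<close> onto
  this kernel. Then \<open>v\<^sup>T A v = v\<^sup>T y\<close>, so \<open>v\<^sup>T A v \<le> y\<^sup>T A\<^sup>-\<^sup>1 y\<close>, and (ii) at \<open>y\<close> is the upper bound
  because \<open>\<bar>y\<bar> \<le> \<bar>x\<bar>\<close>. On \<open>\<V>\<^bsup>(1)\<^esup>\<close> the upper bound is \<open>\<lambda>\<^sub>m\<^sub>i\<^sub>n(A) A\<^sup>-\<^sup>1 \<le> I\<close>.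
  The constant is \<open>C = C\<^sub>d\<^sup>2\<close>.\<close>

subsection \<open>Finite-dimensional linear algebra\<close>

lemma vecs_diff: "x \<in> vecs S \<Longrightarrow> y \<in> vecs S \<Longrightarrow> (\<lambda>i. x i - y i) \<in> vecs S"
  and vecs_add: "x \<in> vecs S \<Longrightarrow> y \<in> vecs S \<Longrightarrow> (\<lambda>i. x i + y i) \<in> vecs S"
  and vecs_scale: "x \<in> vecs S \<Longrightarrow> (\<lambda>i. a * x i) \<in> vecs S"
  by (auto simp: vecs_def)

lemma mats_mult: "M \<in> mats S T \<Longrightarrow> M' \<in> mats U V \<Longrightarrow> mmul X M M' \<in> mats S V"
  by (auto simp: mats_def mmul_def intro!: sum.neutral)

lemma mats_subm: "M \<in> mats S T \<Longrightarrow> M' \<in> mats S T \<Longrightarrow> subm M M' \<in> mats S T"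
  by (auto simp: mats_def subm_def)

lemma mats_transp: "M \<in> mats S T \<Longrightarrow> transp M \<in> mats T S"
  by (auto simp: mats_def transp_def)

lemma mats_idm: "idm S \<in> mats S S"
  by (auto simp: mats_def idm_def)

lemma mapp_vecs: "M \<in> mats S T \<Longrightarrow> mapp X M x \<in> vecs S"
  by (auto simp: mats_def mapp_def vecs_def intro!: sum.neutral)

lemma unitv_vecs: "i \<in> S \<Longrightarrow> unitv i \<in> vecs S"
  by (auto simp: vecs_def unitv_def)

lemma mmul_assoc: "mmul S (mmul T M1 M2) M3 = mmul T M1 (mmul S M2 M3)"
proof (intro ext)
  fix i j
  have "(\<Sum>s\<in>S. (\<Sum>t\<in>T. M1 i t * M2 t s) * M3 s j) = (\<Sum>s\<in>S. \<Sum>t\<in>T. M1 i t * M2 t s * M3 s j)"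
    by (simp add: sum_distrib_right)
  also have "\<dots> = (\<Sum>t\<in>T. \<Sum>s\<in>S. M1 i t * M2 t s * M3 s j)"
    by (rule sum.swap)
  finally show "mmul S (mmul T M1 M2) M3 i j = mmul T M1 (mmul S M2 M3) i j"
    by (simp add: mmul_def sum_distrib_left mult.assoc)
qed

text \<open>A vector is viewed as the matrix \<open>\<lambda>i _. x i\<close>, all of whose columns
  equal \<open>x\<close>, so this is an instance of associativity.\<close>

lemma mapp_mmul: "mapp S (mmul T M1 M2) x = mapp T M1 (mapp S M2 x)"
  using fun_cong[OF mmul_assoc[of S T M1 M2 "\<lambda>i _. x i"]]
  by (auto simp: mmul_def mapp_def fun_eq_iff)

lemma transp_mmul: "transp (mmul S M M') = mmul S (transp M') (transp M)"
  by (simp add: transp_def mmul_def mult.commute)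

lemma transp_transp [simp]: "transp (transp M) = M"
  by (simp add: transp_def)

lemma transp_idm [simp]: "transp (idm S) = idm S"
  by (auto simp: transp_def idm_def fun_eq_iff)

lemma transp_subm: "transp (subm M M') = subm (transp M) (transp M')"
  by (simp add: transp_def subm_def)

lemma mapp_idm: "finite S \<Longrightarrow> x \<in> vecs S \<Longrightarrow> mapp S (idm S) x = x"
  unfolding mapp_def fun_eq_iff
proof (rule allI)
  fix i assume "finite S" "x \<in> vecs S"
  then show "(\<Sum>t\<in>S. idm S i t * x t) = x i"
    by (cases "i \<in> S") (auto simp: idm_def vecs_def if_distrib[of "\<lambda>a. a * _"] cong: if_cong)
qed

lemma mapp_right_inverse:
  "mmul S P Q = idm T \<Longrightarrow> finite T \<Longrightarrow> x \<in> vecs T \<Longrightarrow> mapp S P (mapp T Q x) = x"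
  by (metis mapp_mmul mapp_idm)

lemma idm_mmul: "finite S \<Longrightarrow> M \<in> mats S T \<Longrightarrow> mmul S (idm S) M = M"
  using mapp_idm[of S "\<lambda>i. M i j" for j]
  by (auto simp: mmul_def mapp_def mats_def vecs_def fun_eq_iff)

lemma mmul_idm: "finite T \<Longrightarrow> M \<in> mats S T \<Longrightarrow> mmul T M (idm T) = M"
  using idm_mmul[OF _ mats_transp, of T M S] transp_mmul[of T M "idm T"]
  by (metis transp_transp transp_idm)

lemma subm_mmul: "mmul S (subm M1 M2) M = subm (mmul S M1 M) (mmul S M2 M)"
  by (simp add: mmul_def subm_def left_diff_distrib sum_subtractf)

lemma mmul_subm: "mmul S M (subm M1 M2) = subm (mmul S M M1) (mmul S M M2)"
  by (simp add: mmul_def subm_def right_diff_distrib sum_subtractf)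

lemma mapp_diff: "mapp S M (\<lambda>i. x i - y i) = (\<lambda>i. mapp S M x i - mapp S M y i)"
  by (simp add: mapp_def right_diff_distrib sum_subtractf)

lemma mapp_add: "mapp S M (\<lambda>i. x i + y i) = (\<lambda>i. mapp S M x i + mapp S M y i)"
  by (simp add: mapp_def distrib_left sum.distrib)

lemma mapp_scale: "mapp S M (\<lambda>i. a * x i) = (\<lambda>i. a * mapp S M x i)"
  by (simp add: mapp_def sum_distrib_left mult.left_commute)

lemma mapp_zerov: "mapp S M zerov = zerov"
  by (simp add: mapp_def zerov_def)

lemma mapp_cong: "(\<And>i. i \<in> S \<Longrightarrow> x i = y i) \<Longrightarrow> mapp S M x = mapp S M y"
  by (simp add: mapp_def)

lemma mapp_unitv: "finite S \<Longrightarrow> j \<in> S \<Longrightarrow> mapp S M (unitv j) = (\<lambda>i. M i j)"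
  by (simp add: mapp_def unitv_def if_distrib[of "\<lambda>a. _ * a"] cong: if_cong)

text \<open>Unit vectors recover the columns indexed by \<open>T\<close>, and all other columns
  vanish. This turns arguments about operators into matrix identities.\<close>

lemma mats_eqI:
  assumes "M \<in> mats S T" "M' \<in> mats S' T" "finite T"
    and "\<And>x. x \<in> vecs T \<Longrightarrow> mapp T M x = mapp T M' x"
  shows "M = M'"
proof (intro ext)
  fix i j
  show "M i j = M' i j"
  proof (cases "j \<in> T")
    case True
    with assms(3) assms(4)[OF unitv_vecs[OF True]] show ?thesis
      by (simp add: mapp_unitv fun_eq_iff)
  qed (use assms in \<open>auto simp: mats_def\<close>)
qed

section \<open>Inner products, adjoints and positive definite forms\<close>

lemma dotp_commute: "dotp S x y = dotp S y x"
  by (simp add: dotp_def mult.commute)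

lemma dotp_diff_right: "dotp S x (\<lambda>i. y i - z i) = dotp S x y - dotp S x z"
  by (simp add: dotp_def right_diff_distrib sum_subtractf)

lemma dotp_diff_left: "dotp S (\<lambda>i. y i - z i) x = dotp S y x - dotp S z x"
  by (simp add: dotp_def left_diff_distrib sum_subtractf)

lemma dotp_add_right: "dotp S x (\<lambda>i. y i + z i) = dotp S x y + dotp S x z"
  by (simp add: dotp_def distrib_left sum.distrib)

lemma dotp_add_left: "dotp S (\<lambda>i. y i + z i) x = dotp S y x + dotp S z x"
  by (simp add: dotp_def distrib_right sum.distrib)

lemma dotp_scale_right: "dotp S x (\<lambda>i. a * y i) = a * dotp S x y"
  by (simp add: dotp_def sum_distrib_left mult.left_commute)

lemma dotp_scale_left: "dotp S (\<lambda>i. a * y i) x = a * dotp S y x"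
  by (simp add: dotp_def sum_distrib_left mult.assoc)

lemma dotp_zerov_left: "dotp S zerov x = 0"
  by (simp add: dotp_def zerov_def)

lemma dotp_zerov_right: "dotp S x zerov = 0"
  by (simp add: dotp_def zerov_def)

lemmas dotp_simps = dotp_diff_right dotp_diff_left dotp_add_right dotp_add_left
  dotp_scale_right dotp_scale_left dotp_zerov_left dotp_zerov_right

lemma dotp_unitv: "finite S \<Longrightarrow> i \<in> S \<Longrightarrow> dotp S (unitv i) x = x i"
  by (simp add: dotp_def unitv_def if_distrib[of "\<lambda>a. a * _"] cong: if_cong)

lemma dotp_mapp: "dotp S x (mapp T M y) = dotp T (mapp S (transp M) x) y"
proof -
  have "dotp S x (mapp T M y) = (\<Sum>s\<in>S. \<Sum>t\<in>T. x s * M s t * y t)"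
    by (simp add: dotp_def mapp_def sum_distrib_left mult.assoc)
  also have "\<dots> = (\<Sum>t\<in>T. \<Sum>s\<in>S. x s * M s t * y t)"
    by (rule sum.swap)
  also have "\<dots> = dotp T (mapp S (transp M) x) y"
    by (simp add: dotp_def mapp_def transp_def sum_distrib_left sum_distrib_right mult_ac)
  finally show ?thesis .
qed

lemma dotp_self_nonneg: "0 \<le> dotp S x x"
  by (simp add: dotp_def sum_nonneg)

lemma dotp_self_eq_0: "finite S \<Longrightarrow> x \<in> vecs S \<Longrightarrow> dotp S x x = 0 \<longleftrightarrow> x = zerov"
  by (auto simp: dotp_def sum_nonneg_eq_0_iff vecs_def zerov_def fun_eq_iff)

lemma dotp_self_pos: "finite S \<Longrightarrow> x \<in> vecs S \<Longrightarrow> x \<noteq> zerov \<Longrightarrow> 0 < dotp S x x"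
  by (metis dotp_self_nonneg dotp_self_eq_0 less_eq_real_def)

lemma L2_set_dotp: "L2_set x S = sqrt (dotp S x x)"
  by (simp add: L2_set_def dotp_def power2_eq_square)

lemma posdef_nonneg: "posdef_mat S M \<Longrightarrow> x \<in> vecs S \<Longrightarrow> 0 \<le> dotp S x (mapp S M x)"
  by (cases "x = zerov") (auto simp: posdef_mat_def dotp_zerov_left less_imp_le)

lemma posdef_inj: "posdef_mat S M \<Longrightarrow> x \<in> vecs S \<Longrightarrow> mapp S M x = zerov \<Longrightarrow> x = zerov"
  by (metis posdef_mat_def dotp_zerov_right less_irrefl)

text \<open>The form of \<open>R^T M R\<close> at \<open>x\<close> is the form of \<open>M\<close>
  at \<open>R x\<close>. Both \<open>step_B\<close> and \<open>step_A\<close> are congruences of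
  this kind.\<close>

lemma posdef_congruence:
  assumes "posdef_mat S M" "R \<in> mats S T" "\<And>x. x \<in> vecs T \<Longrightarrow> mapp T R x = zerov \<Longrightarrow> x = zerov"
  shows "posdef_mat T (mmul S (mmul S (transp R) M) R)"
  unfolding posdef_mat_def
proof (intro ballI impI)
  fix x assume x: "x \<in> vecs T" "x \<noteq> zerov"
  have "dotp T x (mapp T (mmul S (mmul S (transp R) M) R) x)
      = dotp S (mapp T R x) (mapp S M (mapp T R x))"
    by (simp add: mapp_mmul dotp_mapp)
  with x assms show "0 < dotp T x (mapp T (mmul S (mmul S (transp R) M) R) x)"
    by (metis posdef_mat_def mapp_vecs)
qed

text \<open>Gaussian elimination, removing one index at a time; the pivot is a value of the quadratic form.\<close>

lemma posdef_solve:
  assumes "finite S" "posdef_mat S M"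
  shows "\<exists>x\<in>vecs S. \<forall>i\<in>S. mapp S M x i = b i"
  using assms
proof (induction S arbitrary: b)
  case empty
  show ?case by (auto simp: vecs_def intro!: exI[of _ zerov] simp: zerov_def)
next
  case (insert s T)
  have ext: "mapp (insert s T) M x i = M i s * x s + mapp T M x i" for x i
    using insert by (simp add: mapp_def)
  have pd: "posdef_mat T M"
    unfolding posdef_mat_def
  proof (intro ballI impI)
    fix x assume x: "x \<in> vecs T" "x \<noteq> zerov"
    then have "x s = 0" "x \<in> vecs (insert s T)"
      using insert by (auto simp: vecs_def)
    with insert(4) x have "0 < dotp (insert s T) x (mapp (insert s T) M x)"
      by (auto simp: posdef_mat_def)
    then show "0 < dotp T x (mapp T M x)"
      using insert \<open>x s = 0\<close> by (simp add: dotp_def ext)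
  qed
  obtain y where y: "y \<in> vecs T" "\<And>i. i \<in> T \<Longrightarrow> mapp T M y i = b i"
    using insert.IH[OF pd, of b] by blast
  \<comment> \<open>The right-hand side is minus column \<open>s\<close>, so that
    \<open>u = z + unitv s\<close> below is annihilated by every row in \<open>T\<close>.\<close>
  obtain z where z: "z \<in> vecs T" "\<And>i. i \<in> T \<Longrightarrow> mapp T M z i = - M i s"
    using insert.IH[OF pd, of "\<lambda>i. - M i s"] by blast
  have ys: "y s = 0" and zs: "z s = 0"
    using y z insert by (auto simp: vecs_def)
  define u where "u = (\<lambda>i. z i + unitv s i)"
  have u: "u \<in> vecs (insert s T)" "u s = 1"
    using z zs by (auto simp: u_def vecs_def unitv_def)
  have mu: "mapp T M u = mapp T M z"
    by (rule mapp_cong) (use insert in \<open>auto simp: u_def unitv_def\<close>)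
  have "u \<noteq> zerov" using u by (auto simp: zerov_def)
  with insert(4) u have "0 < dotp (insert s T) u (mapp (insert s T) M u)"
    by (auto simp: posdef_mat_def)
  moreover have "mapp (insert s T) M u i = 0" if "i \<in> T" for i
    using that z u by (simp add: ext mu)
  \<comment> \<open>Only row \<open>s\<close> contributes to the form at \<open>u\<close>, and
    \<open>u s = 1\<close>, so the pivot is the value of the form at \<open>u\<close>.\<close>
  ultimately have pos: "0 < mapp (insert s T) M u s"
    using insert u by (simp add: dotp_def)
  \<comment> \<open>\<open>t\<close> is forced by row \<open>s\<close>; adding \<open>t * u\<close>
    to \<open>y\<close> leaves the rows in \<open>T\<close> unchanged.\<close>
  define t where "t = (b s - mapp T M y s) / mapp (insert s T) M u s"
  define x where "x = (\<lambda>i. y i + t * u i)"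
  have mx: "mapp (insert s T) M x i = mapp T M y i + t * mapp (insert s T) M u i" for i
    unfolding x_def mapp_add mapp_scale by (simp add: ext ys)
  have "x \<in> vecs (insert s T)"
    using y u by (auto simp: x_def vecs_def)
  moreover have "mapp (insert s T) M x s = b s"
    using pos by (simp add: mx t_def)
  moreover have "mapp (insert s T) M x i = b i" if "i \<in> T" for i
    using that y z u by (simp add: mx) (simp add: ext mu)
  ultimately show ?case by auto
qed

text \<open>Solving against unit vectors gives a right inverse column by column, and injectivity of
  \<open>M\<close> makes it two-sided. Uniqueness then identifies it with the definite description
  \<open>minv\<close>.\<close>

lemma posdef_inverse:
  assumes "finite S" "posdef_mat S M" "M \<in> mats S S"
  shows "minv S M \<in> mats S S" "mmul S M (minv S M) = idm S" "mmul S (minv S M) M = idm S"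
proof -
  have "\<forall>j\<in>S. \<exists>x\<in>vecs S. \<forall>i\<in>S. mapp S M x i = unitv j i"
    using posdef_solve[OF assms(1,2)] by blast
  then obtain X where X: "\<And>j. j \<in> S \<Longrightarrow> X j \<in> vecs S"
    "\<And>j i. j \<in> S \<Longrightarrow> i \<in> S \<Longrightarrow> mapp S M (X j) i = unitv j i"
    by metis
  define Y where "Y = (\<lambda>i j. if j \<in> S then X j i else 0)"
  have Y: "Y \<in> mats S S" using X by (auto simp: Y_def mats_def vecs_def)
  have MY: "mmul S M Y = idm S"
  proof (intro ext)
    fix i j
    show "mmul S M Y i j = idm S i j"
    proof (cases "i \<in> S \<and> j \<in> S")
      case True
      then show ?thesis using X(2)[of j i]
        by (auto simp: mmul_def Y_def mapp_def idm_def unitv_def)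
    next
      case False
      then show ?thesis using mats_mult[OF assms(3) Y, of S] mats_idm[of S]
        by (auto simp: mats_def)
    qed
  qed
  have YM: "mmul S Y M = idm S"
  proof (rule mats_eqI[OF mats_mult[OF Y assms(3)] mats_idm assms(1)])
    fix x assume x: "x \<in> vecs S"
    \<comment> \<open>\<open>M (Y M x - x) = 0\<close> because \<open>M Y = I\<close>, and
      \<open>M\<close> is injective.\<close>
    let ?d = "\<lambda>i. mapp S (mmul S Y M) x i - x i"
    have "mapp S M ?d = zerov"
      using x assms by (simp add: mapp_diff mapp_mmul[symmetric] mmul_assoc[symmetric] MY idm_mmul zerov_def)
    moreover have "?d \<in> vecs S"
      using x mapp_vecs[OF mats_mult[OF Y assms(3)]] by (intro vecs_diff)
    ultimately have "?d = zerov" using posdef_inj[OF assms(2)] by blast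
    then show "mapp S (mmul S Y M) x = mapp S (idm S) x"
      using x assms by (simp add: mapp_idm zerov_def fun_eq_iff)
  qed
  have "minv S M = Y"
    unfolding minv_def
  proof (rule the_equality)
    fix Z assume Z: "Z \<in> mats S S \<and> mmul S M Z = idm S \<and> mmul S Z M = idm S"
    then have "Z = mmul S Z (mmul S M Y)" using MY mmul_idm[OF assms(1), of Z S] by simp
    also have "\<dots> = Y" using Z Y assms by (simp add: mmul_assoc[symmetric] idm_mmul)
    finally show "Z = Y" .
  qed (use Y MY YM in simp)
  with Y MY YM show "minv S M \<in> mats S S" "mmul S M (minv S M) = idm S" "mmul S (minv S M) M = idm S"
    by auto
qed

subsection \<open>The smallest eigenvalue\<close>

text \<open>The form is continuous on the compact unit sphere, hence has a minimiser; homogeneity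
  extends the bound to all vectors.\<close>

lemma rayleigh_minimum:
  assumes "finite S" "S \<noteq> {}"
  obtains v where "v \<in> vecs S" "dotp S v v = 1"
    "\<And>x. x \<in> vecs S \<Longrightarrow> dotp S v (mapp S M v) * dotp S x x \<le> dotp S x (mapp S M x)"
proof -
  \<comment> \<open>Vectors are functions on the infinite type of tuples, so compactness is taken in
    a product: \<open>{-1..1}\<close> at indices in \<open>S\<close>, \<open>{0}\<close> elsewhere.
    The unit sphere of \<open>vecs S\<close> is a closed subset of this box.\<close>
  let ?B = "PiE UNIV (\<lambda>i. if i \<in> S then {-1..1} else {0::real})"
  let ?K = "?B \<inter> {x. dotp S x x = 1}"
  have [continuous_intros]: "continuous_on UNIV (\<lambda>x. dotp S x x)"
    unfolding dotp_def by (intro continuous_intros) auto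
  have cont: "continuous_on UNIV (\<lambda>x. dotp S x (mapp S M x))"
    unfolding dotp_def mapp_def by (intro continuous_intros) auto
  have "compact ?B"
    unfolding compactin_euclidean_iff[symmetric] euclidean_product_topology[symmetric] compactin_PiE
    by auto
  moreover have "closed {x. dotp S x x = 1}"
    by (intro closed_Collect_eq continuous_intros)
  ultimately have "compact ?K" by (rule compact_Int_closed)
  have in_K: "x \<in> ?K" if "x \<in> vecs S" "dotp S x x = 1" for x
  proof -
    have "\<bar>x i\<bar> \<le> 1" if "i \<in> S" for i
    proof -
      have "x i * x i \<le> dotp S x x"
        unfolding dotp_def by (rule member_le_sum) (use assms that in auto)
      with \<open>dotp S x x = 1\<close> show ?thesis using abs_square_le_1[of "x i"] by (simp add: power2_eq_square)
    qed
    then show ?thesis using that by (auto simp: vecs_def abs_le_iff minus_le_iff)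
  qed
  obtain s where "s \<in> S" using assms by auto
  have "unitv s \<in> ?K"
    using in_K[OF unitv_vecs[OF \<open>s \<in> S\<close>]] dotp_unitv[OF assms(1) \<open>s \<in> S\<close>, of "unitv s"]
    by (simp add: unitv_def)
  then obtain v where v: "v \<in> ?K" "\<And>y. y \<in> ?K \<Longrightarrow> dotp S v (mapp S M v) \<le> dotp S y (mapp S M y)"
    using continuous_attains_inf[OF \<open>compact ?K\<close> _ continuous_on_subset[OF cont subset_UNIV]] by blast
  show ?thesis
  proof
    show "v \<in> vecs S" unfolding vecs_def
    proof (safe)
      fix i assume "i \<notin> S" then show "v i = 0" using v(1) by (auto simp: PiE_def Pi_def dest: spec[of _ i])
    qed
    show "dotp S v v = 1" using v(1) by simp
    fix x assume x: "x \<in> vecs S"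
    show "dotp S v (mapp S M v) * dotp S x x \<le> dotp S x (mapp S M x)"
    proof (cases "x = zerov")
      case False
      define r where "r = dotp S x x"
      have r: "r > 0" using x False assms by (simp add: r_def dotp_self_pos)
      have "(\<lambda>i. inverse (sqrt r) * x i) \<in> ?K"
      proof (rule in_K)
        have "inverse (sqrt r) * (inverse (sqrt r) * r) = inverse r * r"
          using r by (metis mult.assoc inverse_mult_distrib real_sqrt_mult_self abs_of_pos)
        with r show "dotp S (\<lambda>i. inverse (sqrt r) * x i) (\<lambda>i. inverse (sqrt r) * x i) = 1"
          by (simp add: dotp_simps flip: r_def)
      qed (use x in \<open>rule vecs_scale\<close>)
      from v(2)[OF this] have "dotp S v (mapp S M v) \<le> inverse r * dotp S x (mapp S M x)"
        using r by (simp add: dotp_simps mapp_scale flip: mult.assoc inverse_mult_distrib)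
      with r show ?thesis by (simp add: field_simps flip: r_def)
    qed (simp add: dotp_zerov_left)
  qed
qed

text \<open>The Rayleigh minimiser is an eigenvector by a first variation, and every eigenvalue is a
  Rayleigh quotient. So the minimum is an eigenvalue below all others, as \<open>LEAST\<close> over
  the reals requires.\<close>

lemma lambda_min_posdef:
  assumes "finite S" "S \<noteq> {}" "M \<in> mats S S" "transp M = M" "posdef_mat S M"
  shows "lambda_min S M > 0"
    and "x \<in> vecs S \<Longrightarrow> lambda_min S M * dotp S x x \<le> dotp S x (mapp S M x)"
proof -
  obtain v where v: "v \<in> vecs S" "dotp S v v = 1"
    "\<And>x. x \<in> vecs S \<Longrightarrow> dotp S v (mapp S M v) * dotp S x x \<le> dotp S x (mapp S M x)"
    using rayleigh_minimum[OF assms(1,2)] by metis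
  define l where "l = dotp S v (mapp S M v)"
  have v0: "v \<noteq> zerov" using v(2) by (auto simp: dotp_zerov_left)
  have ort: "dotp S w (mapp S M v) - l * dotp S w v = 0" if w: "w \<in> vecs S" for w
  proof -
    \<comment> \<open>Along \<open>v + t w\<close>, the form minus \<open>l\<close> times the
      squared norm has no constant term; \<open>a\<close> is half its linear coefficient in
      \<open>t\<close> and \<open>c\<close> is its quadratic one.\<close>
    define a where "a = dotp S w (mapp S M v) - l * dotp S w v"
    define c where "c = dotp S w (mapp S M w) - l * dotp S w w"
    have "dotp S v (mapp S M w) = dotp S w (mapp S M v)"
      using assms(4) by (metis dotp_mapp dotp_commute)
    then have nonneg: "0 \<le> 2 * t * a + t * t * c" for t
      using v(3)[of "\<lambda>i. v i + t * w i"] v w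
      by (simp add: vecs_add vecs_scale mapp_add mapp_scale dotp_simps dotp_commute[of S v w]
          a_def c_def algebra_simps flip: l_def)
    have c: "0 \<le> c" using v(3)[OF w] by (simp add: c_def l_def)
    have "a = 0"
    proof (rule ccontr)
      assume "a \<noteq> 0"
      \<comment> \<open>For this \<open>t\<close> the expression in \<open>nonneg\<close> equals
        \<open>- (t * t * (c + 2))\<close>, which is negative. The \<open>+ 1\<close> keeps the
        denominator positive when \<open>c = 0\<close>.\<close>
      define t where "t = - a / (c + 1)"
      have a: "a = - (t * (c + 1))" using c by (simp add: t_def)
      then have "0 < t * t" using \<open>a \<noteq> 0\<close> by (auto simp: zero_less_mult_iff)
      then have "0 < t * t * (c + 2)" using c by simp
      with nonneg[of t] show False by (simp add: a algebra_simps)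
    qed
    then show ?thesis by (simp add: a_def)
  qed
  have "mapp S M v i = l * v i" for i
  proof (cases "i \<in> S")
    case True
    then show ?thesis using ort[OF unitv_vecs[OF True]] assms by (simp add: dotp_unitv)
  next
    case False
    then show ?thesis using v(1) mapp_vecs[OF assms(3), of S v] by (simp add: vecs_def)
  qed
  then have eig: "is_eigenvalue S M l"
    using v v0 by (auto simp: is_eigenvalue_def)
  have "lambda_min S M = l"
    unfolding lambda_min_def
  proof (rule Least_equality, rule eig)
    fix m assume "is_eigenvalue S M m"
    then obtain w where w: "w \<in> vecs S" "w \<noteq> zerov" "mapp S M w = (\<lambda>i. m * w i)"
      by (auto simp: is_eigenvalue_def)
    with v(3)[of w] dotp_self_pos[of S w] assms(1) show "l \<le> m"
      by (simp add: dotp_simps flip: l_def)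
  qed
  with v v0 assms(5) show "lambda_min S M > 0"
    "x \<in> vecs S \<Longrightarrow> lambda_min S M * dotp S x x \<le> dotp S x (mapp S M x)"
    by (auto simp: l_def posdef_mat_def)
qed

subsection \<open>The gamblet transform\<close>

lemma mats_zero: "(\<lambda>_ _. 0) \<in> mats S T"
  by (simp add: mats_def)

lemma mmul_zero: "mmul S M (\<lambda>_ _. 0) = (\<lambda>_ _. 0)"
  by (simp add: mmul_def)

lemma zero_mmul: "mmul S (\<lambda>_ _. 0) M = (\<lambda>_ _. 0)"
  by (simp add: mmul_def)

lemma transp_zero: "transp (\<lambda>_ _. 0) = (\<lambda>_ _. 0)"
  by (simp add: transp_def)

lemma mapp_zero: "mapp S (\<lambda>_ _. 0) x = zerov"
  by (simp add: mapp_def zerov_def)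

section \<open>One step of the transform: fine indices \<open>S\<close>, coarse indices
  \<open>U\<close>, detail indices \<open>T\<close>\<close>

context
  fixes S T U :: "tuple set" and P w :: tmat
  assumes fin: "finite S" "finite T" "finite U"
    and P: "P \<in> mats U S" "mmul S P (transp P) = idm U"
    and w: "w \<in> mats T S" "mmul S w (transp w) = idm T"
    and img: "image_of T (transp w) = kernel_of S P"
begin

lemma complement_orthogonal: "mmul S P (transp w) = (\<lambda>_ _. 0)"
proof (rule mats_eqI[OF mats_mult[OF P(1) mats_transp[OF w(1)]] mats_zero fin(2)])
  fix x assume "x \<in> vecs T"
  then have "mapp T (transp w) x \<in> kernel_of S P"
    using img by (auto simp: image_of_def)
  then show "mapp T (mmul S P (transp w)) x = mapp T (\<lambda>_ _. 0) x"
    by (simp add: kernel_of_def mapp_mmul mapp_zero)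
qed

lemma complement_orthogonal': "mmul S w (transp P) = (\<lambda>_ _. 0)"
  using arg_cong[OF complement_orthogonal, of transp] by (simp add: transp_mmul transp_zero)

text \<open>\<open>x - P^T P x\<close> lies in \<open>Ker P = Im w^T\<close>, hence is
  \<open>w^T y\<close> for some \<open>y\<close>. Applying \<open>w\<close> gives
  \<open>y = w x\<close>, since \<open>w w^T = I\<close> and \<open>w P^T = 0\<close>.\<close>

lemma complement_projection: "subm (idm S) (mmul T (transp w) w) = mmul U (transp P) P"
proof (rule mats_eqI[OF mats_subm[OF mats_idm mats_mult] mats_mult fin(1)])
  fix x assume x: "x \<in> vecs S"
  define z where "z = (\<lambda>i. x i - mapp U (transp P) (mapp S P x) i)"
  have "mapp S P (mapp U (transp P) (mapp S P x)) = mapp S P x"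
    by (rule mapp_right_inverse[OF P(2) fin(3) mapp_vecs[OF P(1)]])
  then have "mapp S P z = zerov"
    by (simp add: z_def mapp_diff zerov_def)
  moreover have "z \<in> vecs S"
    unfolding z_def using x P by (intro vecs_diff mapp_vecs mats_transp)
  ultimately obtain y where y: "y \<in> vecs T" "z = mapp T (transp w) y"
    using img by (auto simp: image_of_def kernel_of_def)
  have "mapp S w z = y"
    unfolding y(2) by (rule mapp_right_inverse[OF w(2) fin(2) y(1)])
  moreover have "mapp S w (mapp U (transp P) (mapp S P x)) = zerov"
    using mapp_mmul[of U S w "transp P" "mapp S P x"] by (simp add: complement_orthogonal' mapp_zero)
  then have "mapp S w z = mapp S w x"
    by (simp add: z_def mapp_diff zerov_def)
  ultimately have "mapp T (transp w) (mapp S w x) = z"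
    using y by simp
  moreover have "mapp S (subm (idm S) (mmul T (transp w) w)) x
      = (\<lambda>i. x i - mapp T (transp w) (mapp S w x) i)"
    using mapp_idm[OF fin(1) x] mapp_mmul[of S T "transp w" w x]
    by (simp add: mapp_def subm_def left_diff_distrib sum_subtractf fun_eq_iff)
  ultimately show "mapp S (subm (idm S) (mmul T (transp w) w)) x = mapp S (mmul U (transp P) P) x"
    by (simp add: z_def mapp_mmul)
qed (use P w in \<open>auto intro: mats_transp\<close>)

context
  fixes M :: tmat
  assumes M: "M \<in> mats S S" "transp M = M" "posdef_mat S M"
begin

lemma step_B_mats: "step_B S w M \<in> mats T T"
  unfolding step_B_def using w M by (intro mats_mult mats_transp)

text \<open>\<open>w w^T = I\<close> makes \<open>w^T\<close> injective. Positivity ensures that the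
  \<open>minv\<close> inside \<open>step_N\<close> is a genuine inverse.\<close>

lemma step_B_posdef: "posdef_mat T (step_B S w M)"
  unfolding step_B_def
proof (rule posdef_congruence[of S M "transp w" T, simplified])
  fix x assume "x \<in> vecs T" "mapp T (transp w) x = zerov"
  then show "x = zerov"
    using mapp_right_inverse[OF w(2) fin(2)] by (metis mapp_zerov)
qed (use M w in \<open>auto intro: mats_transp\<close>)

lemmas step_B_inverse = posdef_inverse[OF fin(2) step_B_posdef step_B_mats]

lemma step_R_mats: "step_R S T P w M \<in> mats U S"
  unfolding step_R_def step_N_def
  by (rule mats_mult[OF P(1) mats_subm[OF mats_idm mats_mult[OF mats_mult[OF mats_mult[OF M(1)
      mats_transp[OF w(1)]] step_B_inverse(1)] w(1)]]])

text \<open>The correction term of \<open>R\<close> ends in \<open>w\<close>, and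
  \<open>w P^T = 0\<close>, so only \<open>P P^T\<close> remains.\<close>

lemma step_R_transp: "mmul S (step_R S T P w M) (transp P) = idm U"
  unfolding step_R_def using fin P
  by (simp add: mmul_assoc subm_mmul complement_orthogonal' mmul_zero idm_mmul[OF _ mats_transp]) 
     (simp add: subm_def)

text \<open>\<open>N w M w^T = M w^T B^-1 B = M w^T\<close>, so \<open>I - N w\<close> annihilates
  \<open>M w^T\<close>. This is the orthogonality of coarse and detail functions in the inner
  product of \<open>M\<close>.\<close>

lemma step_R_orthogonal: "mmul S (step_R S T P w M) (mmul S M (transp w)) = (\<lambda>_ _. 0)"
proof -
  have "mmul S (mmul T (step_N S T w M) w) (mmul S M (transp w))
      = mmul T (mmul S M (transp w)) (mmul T (minv T (step_B S w M)) (step_B S w M))"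
    by (simp add: step_N_def step_B_def mmul_assoc)
  also have "\<dots> = mmul S M (transp w)"
    unfolding step_B_inverse(3) using fin M w by (intro mmul_idm mats_mult mats_transp)
  finally have "subm (mmul S (idm S) (mmul S M (transp w)))
      (mmul S (mmul T (step_N S T w M) w) (mmul S M (transp w))) = (\<lambda>_ _. 0)"
    using idm_mmul[OF fin(1) mats_mult[OF M(1) mats_transp[OF w(1)]], of S]
    by (simp add: subm_def)
  then show ?thesis
    by (simp add: step_R_def mmul_assoc[of S S P] subm_mmul mmul_zero)
qed

text \<open>Only the right factor \<open>R^T\<close> is expanded. Its correction enters through
  \<open>M w^T\<close>, which the left factor \<open>R\<close> annihilates.\<close>

lemma step_A_eq: "step_A S T P w M = mmul S (step_R S T P w M) (mmul S M (transp P))"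
proof -
  let ?R = "step_R S T P w M"
  have "mmul S M (transp ?R)
      = subm (mmul S M (transp P)) (mmul T (mmul S M (transp w)) (mmul S (transp (step_N S T w M)) (transp P)))"
    using fin P by (simp add: step_R_def transp_mmul transp_subm subm_mmul mmul_subm
        idm_mmul[OF _ mats_transp] mmul_assoc)
  then show ?thesis
    by (simp add: step_A_def mmul_assoc[of S S ?R] mmul_subm mmul_assoc[of T S ?R, symmetric]
        step_R_orthogonal zero_mmul) (simp add: subm_def)
qed

lemma step_A_mats: "step_A S T P w M \<in> mats U U"
  unfolding step_A_def using step_R_mats M by (intro mats_mult mats_transp)

lemma step_A_symmetric: "transp (step_A S T P w M) = step_A S T P w M"
  by (simp add: step_A_def transp_mmul M(2) mmul_assoc)

lemma step_A_posdef: "posdef_mat U (step_A S T P w M)"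
  unfolding step_A_def
proof (rule posdef_congruence[of S M "transp (step_R S T P w M)" U, simplified])
  fix x assume x: "x \<in> vecs U" "mapp U (transp (step_R S T P w M)) x = zerov"
  \<comment> \<open>\<open>P\<close> is a left inverse of \<open>R^T\<close>, which is therefore
    injective.\<close>
  have "mmul S P (transp (step_R S T P w M)) = idm U"
    using arg_cong[OF step_R_transp, of transp] by (simp add: transp_mmul)
  then show "x = zerov"
    using x mapp_right_inverse fin(3) by (metis mapp_zerov)
qed (use M step_R_mats in \<open>auto intro: mats_transp\<close>)

text \<open>Since \<open>R M w\<^sup>T = 0\<close> and \<open>I = w\<^sup>T w + P\<^sup>T P\<close>, one has \<open>R M = R M P\<^sup>T P\<close>, and \<open>R M P\<^sup>T\<close> is the coarse
  matrix.\<close>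

lemma step_intertwine: "mmul S M (transp (step_R S T P w M)) = mmul U (transp P) (step_A S T P w M)"
proof -
  let ?R = "step_R S T P w M"
  have "mmul U (step_A S T P w M) P = mmul S (mmul S ?R M) (mmul U (transp P) P)"
    by (simp add: step_A_eq mmul_assoc)
  also have "\<dots> = subm (mmul S (mmul S ?R M) (idm S)) (mmul T (mmul S ?R (mmul S M (transp w))) w)"
    by (simp add: complement_projection[symmetric] mmul_subm mmul_assoc)
  also have "\<dots> = mmul S ?R M"
    using mmul_idm[OF fin(1) mats_mult[OF step_R_mats M(1)], of S]
    by (simp add: step_R_orthogonal zero_mmul) (simp add: subm_def)
  finally have "transp (mmul S ?R M) = transp (mmul U (step_A S T P w M) P)"
    by simp
  then show ?thesis
    by (simp add: transp_mmul M(2) step_A_symmetric)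
qed

end

end

section \<open>The recursion over all levels\<close>

locale gamblet =
  fixes q :: nat and I :: "tuple set" and J :: "nat \<Rightarrow> tuple set" and p W :: "nat \<Rightarrow> tmat"
    and A :: tmat
  assumes tree: "index_tree q I" and pi: "pi_family q I p"
    and J: "J_family q I J" and W: "W_family q I J p W"
    and A: "A \<in> mats I I" "transp A = A" "posdef_mat I A"
begin

abbreviation "L \<equiv> level I"
abbreviation "PQ \<equiv> pi_to_q q I p"
abbreviation "\<A> \<equiv> gamblet_A q I J p W A"
abbreviation "\<R> \<equiv> gamblet_R q I J p W A"
abbreviation "\<Psi> \<equiv> gamblet_psi q I J p W A"

lemma finite_I: "finite I" and finite_level: "finite (L k)"
  using tree by (auto simp: index_tree_def level_def)

lemma level_q: "L q = I"
  using tree by (auto simp: index_tree_def level_def image_iff)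

lemma p_mats: "k \<in> {1..<q} \<Longrightarrow> p k \<in> mats (L k) (L (Suc k))"
  and p_isometry: "k \<in> {1..<q} \<Longrightarrow> mmul (L (Suc k)) (p k) (transp (p k)) = idm (L k)"
  using pi by (auto simp: pi_family_def)

lemma finite_J: "k \<in> {2..q} \<Longrightarrow> finite (J k)"
  using J by (auto simp: J_family_def)

lemma W_mats: "k \<in> {2..q} \<Longrightarrow> W k \<in> mats (J k) (L k)"
  and W_isometry: "k \<in> {2..q} \<Longrightarrow> mmul (L k) (W k) (transp (W k)) = idm (J k)"
  and W_image: "k \<in> {2..q} \<Longrightarrow> image_of (J k) (transp (W k)) = kernel_of (L k) (p (k - 1))"
  using W by (auto simp: W_family_def)

lemma p_W:
  assumes "k \<in> {2..q}"
  shows "mmul (L k) (p (k - 1)) (transp (W k)) = (\<lambda>_ _. 0)"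
proof -
  from assms have "k - 1 \<in> {1..<q}" "Suc (k - 1) = k" by auto
  then have "p (k - 1) \<in> mats (L (k - 1)) (L k)"
    "mmul (L k) (p (k - 1)) (transp (p (k - 1))) = idm (L (k - 1))"
    using p_mats[of "k - 1"] p_isometry[of "k - 1"] by auto
  then show ?thesis
    using assms by (intro complement_orthogonal[OF finite_level finite_J finite_level _ _ W_mats
      W_isometry W_image])
qed

lemma Pi_q: "PQ q = idm I"
  by (simp add: pi_to_q.simps)

lemma Pi_step: "k < q \<Longrightarrow> PQ k = mmul (L (Suc k)) (p k) (PQ (Suc k))"
  by (subst pi_to_q.simps) simp

lemma A_q: "\<A> q = A"
  by (simp add: gamblet_A.simps)

lemma A_step: "k < q \<Longrightarrow>
    \<A> k = step_A (L (Suc k)) (J (Suc k)) (p k) (W (Suc k)) (\<A> (Suc k))"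
  by (subst gamblet_A.simps) simp

lemma psi_q: "\<Psi> q = unitv"
  by (simp add: gamblet_psi.simps fun_eq_iff)

lemma psi_step: "k < q \<Longrightarrow> \<Psi> k = mmul (L (Suc k)) (\<R> k) (\<Psi> (Suc k))"
proof (rule ext)
  fix i assume "k < q"
  then show "\<Psi> k i = mmul (L (Suc k)) (\<R> k) (\<Psi> (Suc k)) i"
    by (subst gamblet_psi.simps) (simp add: mmul_def)
qed

text \<open>Descending from level \<open>q\<close>, the innermost factors of the product collapse to
  an identity one after another.\<close>

lemma Pi_isometry:
  assumes "k \<in> {1..q}"
  shows "PQ k \<in> mats (L k) I \<and> mmul I (PQ k) (transp (PQ k)) = idm (L k)"
proof -
  from assms have "k \<le> q" "1 \<le> k" by auto
  then show ?thesis
  proof (induction rule: inc_induct)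
    case base
    show ?case
      using idm_mmul[OF finite_I mats_idm] by (simp add: Pi_q level_q mats_idm)
  next
    case (step n)
    then have IH: "PQ (Suc n) \<in> mats (L (Suc n)) I"
      "mmul I (PQ (Suc n)) (transp (PQ (Suc n))) = idm (L (Suc n))" and n: "n \<in> {1..<q}"
      by auto
    have "mmul I (PQ n) (transp (PQ n))
        = mmul (L (Suc n)) (p n) (mmul (L (Suc n)) (mmul I (PQ (Suc n)) (transp (PQ (Suc n)))) (transp (p n)))"
      using n by (simp add: Pi_step transp_mmul mmul_assoc)
    also have "\<dots> = idm (L n)"
      unfolding IH(2) using p_isometry[OF n] idm_mmul[OF finite_level mats_transp[OF p_mats[OF n]]]
      by simp
    finally show ?case
      using mats_mult[OF p_mats[OF n] IH(1)] n by (simp add: Pi_step)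
  qed
qed

text \<open>A single downward induction carries everything: the facts on \<open>\<A> k\<close>
  license the one-step lemmas, and the last two conjuncts are biorthogonality and intertwining.
  Indices are restricted to \<open>L k\<close> because \<open>\<Psi> q i\<close> is
  \<open>unitv i\<close> even for tuples outside \<open>I\<close>.\<close>

lemma level_invariant:
  assumes "k \<in> {1..q}"
  shows "\<A> k \<in> mats (L k) (L k) \<and> transp (\<A> k) = \<A> k \<and> posdef_mat (L k) (\<A> k) \<and>
    (\<forall>i\<in>L k. \<Psi> k i \<in> vecs I) \<and>
    (\<forall>i\<in>L k. \<forall>j. mmul I (\<Psi> k) (transp (PQ k)) i j = idm (L k) i j) \<and>
    (\<forall>i. \<forall>j\<in>L k. mmul I A (transp (\<Psi> k)) i j = mmul (L k) (transp (PQ k)) (\<A> k) i j)"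
proof -
  from assms have "k \<le> q" "1 \<le> k" by auto
  then show ?thesis
  proof (induction rule: inc_induct)
    case base
    have "mmul I A (transp unitv) i j = A i j" if "j \<in> I" for i j
      using mapp_unitv[OF finite_I that, of A] by (simp add: mmul_def mapp_def transp_def fun_eq_iff)
    moreover have "mmul I unitv (idm I) i j = idm I i j" if "i \<in> I" for i j
      using dotp_unitv[OF finite_I that, of "\<lambda>t. idm I t j"] by (simp add: mmul_def dotp_def)
    ultimately show ?case
      using finite_I A by (auto simp: Pi_q level_q A_q psi_q idm_mmul unitv_vecs)
  next
    case (step n)
    let ?S = "L (Suc n)"
    from step have n: "n \<in> {1..<q}" "n < q" "Suc n \<in> {2..q}" by auto
    from step n have M: "\<A> (Suc n) \<in> mats ?S ?S" "transp (\<A> (Suc n)) = \<A> (Suc n)"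
        "posdef_mat ?S (\<A> (Suc n))"
      and psi: "\<And>i. i \<in> ?S \<Longrightarrow> \<Psi> (Suc n) i \<in> vecs I"
      and bi: "\<And>i j. i \<in> ?S \<Longrightarrow> mmul I (\<Psi> (Suc n)) (transp (PQ (Suc n))) i j = idm ?S i j"
      and inter: "\<And>i j. j \<in> ?S \<Longrightarrow>
        mmul I A (transp (\<Psi> (Suc n))) i j = mmul ?S (transp (PQ (Suc n))) (\<A> (Suc n)) i j"
      by auto
    have img: "image_of (J (Suc n)) (transp (W (Suc n))) = kernel_of ?S (p n)"
      using W_image[OF n(3)] by simp
    note hyps = finite_level finite_J[OF n(3)] finite_level p_mats[OF n(1)] p_isometry[OF n(1)]
      W_mats[OF n(3)] W_isometry[OF n(3)] img M
    have R: "\<R> n = step_R ?S (J (Suc n)) (p n) (W (Suc n)) (\<A> (Suc n))"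
      by (simp add: gamblet_R_def)
    have An: "\<A> n = step_A ?S (J (Suc n)) (p n) (W (Suc n)) (\<A> (Suc n))"
      using n by (simp add: A_step)
    have "mmul I (\<Psi> n) (transp (PQ n))
        = mmul ?S (mmul ?S (\<R> n) (mmul I (\<Psi> (Suc n)) (transp (PQ (Suc n))))) (transp (p n))"
      using n by (simp add: psi_step Pi_step transp_mmul mmul_assoc)
    \<comment> \<open>The contraction runs over \<open>?S\<close>, exactly the rows on which
      biorthogonality is known.\<close>
    also have "mmul ?S (\<R> n) (mmul I (\<Psi> (Suc n)) (transp (PQ (Suc n)))) = mmul ?S (\<R> n) (idm ?S)"
      using bi by (simp add: mmul_def fun_eq_iff)
    also have "\<dots> = \<R> n"
      unfolding R by (rule mmul_idm[OF finite_level step_R_mats[OF hyps]])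
    also have "mmul ?S (\<R> n) (transp (p n)) = idm (L n)"
      unfolding R by (rule step_R_transp[OF hyps])
    finally have bi': "mmul I (\<Psi> n) (transp (PQ n)) = idm (L n)" .
    \<comment> \<open>Peeling \<open>\<R> n\<close> off \<open>\<Psi> n\<close> exposes
      \<open>\<A> (Suc n)\<close> times the transpose of \<open>\<R> n\<close>; the one-step
      intertwining turns this into the transpose of \<open>p n\<close> times \<open>\<A> n\<close>,
      and \<open>p n\<close> is absorbed into \<open>PQ n\<close>.\<close>
    have "mmul I A (transp (\<Psi> n)) = mmul ?S (mmul I A (transp (\<Psi> (Suc n)))) (transp (\<R> n))"
      using n by (simp add: psi_step transp_mmul mmul_assoc)
    also have "\<dots> = mmul ?S (mmul ?S (transp (PQ (Suc n))) (\<A> (Suc n))) (transp (\<R> n))"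
      using inter by (simp add: mmul_def[of ?S _ "transp (\<R> n)"])
    also have "\<dots> = mmul ?S (transp (PQ (Suc n))) (mmul (L n) (transp (p n)) (\<A> n))"
      unfolding R An mmul_assoc step_intertwine[OF hyps] ..
    also have "\<dots> = mmul (L n) (transp (PQ n)) (\<A> n)"
      using n by (simp add: Pi_step transp_mmul mmul_assoc)
    finally have "mmul I A (transp (\<Psi> n)) = mmul (L n) (transp (PQ n)) (\<A> n)" .
    moreover have "\<Psi> n i \<in> vecs I" for i
      using n psi by (auto simp: psi_step mmul_def vecs_def intro!: sum.neutral)
    ultimately show ?case
      using bi' step_A_mats[OF hyps] step_A_symmetric[OF hyps] step_A_posdef[OF hyps]
      by (simp add: An)
  qed
qed

text \<open>Span coefficients are arbitrary functions, hence a \<open>range\<close> instead of the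
  image of \<open>vecs (L k)\<close>; only their values on \<open>L k\<close> enter.\<close>

lemma V_space_eq: "V_space q I J p W A k = range (mapp (L k) (transp (\<Psi> k)))"
  by (auto simp: V_space_def span_of_def mapp_def transp_def image_def mult.commute)

lemma W_space_eq: "W_space q I J p W A k
    = range (\<lambda>c. mapp (L k) (transp (\<Psi> k)) (mapp (J k) (transp (W k)) c))"
proof -
  have "gamblet_chi q I J p W A k = mmul (L k) (W k) (\<Psi> k)"
    by (simp add: gamblet_chi_def mmul_def fun_eq_iff)
  then have "W_space q I J p W A k = range (mapp (J k) (transp (mmul (L k) (W k) (\<Psi> k))))"
    by (auto simp: W_space_def span_of_def mapp_def transp_def image_def mult.commute)
  then show ?thesis
    by (simp add: transp_mmul mapp_mmul)
qed

lemma V_space_properties: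
  assumes "k \<in> {1..q}" "v \<in> V_space q I J p W A k"
  shows "v \<in> vecs I" "mapp I A v \<in> image_of (L k) (pi_from_q q I p k)"
proof -
  from assms obtain c where c: "v = mapp (L k) (transp (\<Psi> k)) c"
    by (auto simp: V_space_eq)
  note inv = level_invariant[OF assms(1)]
  show "v \<in> vecs I"
    using inv by (auto simp: c mapp_def transp_def vecs_def intro!: sum.neutral)
  have "mapp I A v = mapp (L k) (mmul I A (transp (\<Psi> k))) c"
    by (simp add: c mapp_mmul)
  also have "\<dots> = mapp (L k) (mmul (L k) (transp (PQ k)) (\<A> k)) c"
    using inv by (simp add: mapp_def)
  also have "\<dots> = mapp (L k) (transp (PQ k)) (mapp (L k) (\<A> k) c)"
    by (simp add: mapp_mmul)
  finally show "mapp I A v \<in> image_of (L k) (pi_from_q q I p k)"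
    using inv mapp_vecs by (auto simp: image_of_def pi_from_q_def)
qed

lemma W_space_subset: "W_space q I J p W A k \<subseteq> V_space q I J p W A k"
  by (auto simp: W_space_eq V_space_eq)

text \<open>For \<open>v = \<Psi>^T W^T c\<close>, biorthogonality at level \<open>k\<close> gives
  \<open>PQ k v = W^T c\<close>, and the extra factor \<open>p (k - 1)\<close> of
  \<open>PQ (k - 1)\<close> kills the image of \<open>W^T\<close>.\<close>

lemma W_space_kernel:
  assumes k: "k \<in> {2..q}" and v: "v \<in> W_space q I J p W A k"
  shows "mapp I (PQ (k - 1)) v = zerov"
proof -
  from k have k': "k \<in> {1..q}" "k - 1 < q" "Suc (k - 1) = k" by auto
  from v obtain c where c: "v = mapp (L k) (transp (\<Psi> k)) (mapp (J k) (transp (W k)) c)"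
    by (auto simp: W_space_eq)
  let ?d = "mapp (J k) (transp (W k)) c"
  have d: "?d \<in> vecs (L k)"
    by (intro mapp_vecs[OF mats_transp[OF W_mats[OF k]]])
  have "mmul I (PQ k) (transp (\<Psi> k)) i j = idm (L k) i j" if "j \<in> L k" for i j
  proof -
    have "mmul I (PQ k) (transp (\<Psi> k)) i j = mmul I (\<Psi> k) (transp (PQ k)) j i"
      by (simp add: mmul_def transp_def mult.commute)
    also have "\<dots> = idm (L k) j i"
      using level_invariant[OF k'(1)] that by blast
    finally show ?thesis by (auto simp: idm_def)
  qed
  then have "mapp (L k) (mmul I (PQ k) (transp (\<Psi> k))) ?d = mapp (L k) (idm (L k)) ?d"
    by (simp add: mapp_def[of "L k"])
  then have "mapp I (PQ k) v = ?d"
    using mapp_idm[OF finite_level d] by (simp add: c mapp_mmul)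
  then have "mapp I (PQ (k - 1)) v = mapp (L k) (p (k - 1)) ?d"
    using Pi_step[OF k'(2)] k'(3) by (simp add: mapp_mmul)
  also have "\<dots> = zerov"
    using p_W[OF k] by (simp add: mapp_zero flip: mapp_mmul)
  finally show ?thesis .
qed

end

subsection \<open>Energy estimates\<close>

definition inv_form :: "tuple set \<Rightarrow> tmat \<Rightarrow> tvec \<Rightarrow> real" where
  "inv_form S M x = dotp S x (mapp S (minv S M) x)"

context
  fixes S :: "tuple set" and M :: tmat
  assumes S: "finite S" "S \<noteq> {}" and M: "M \<in> mats S S" "transp M = M" "posdef_mat S M"
begin

lemma mapp_inverse:
  assumes "x \<in> vecs S"
  shows "mapp S (minv S M) x \<in> vecs S" "mapp S M (mapp S (minv S M) x) = x"
    "mapp S (minv S M) (mapp S M x) = x"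
  using posdef_inverse[OF S(1) M(3,1)] assms S
  by (auto simp: mapp_idm simp flip: mapp_mmul intro: mapp_vecs)

lemma inv_form_apply: "v \<in> vecs S \<Longrightarrow> inv_form S M (mapp S M v) = dotp S v (mapp S M v)"
  by (simp add: inv_form_def mapp_inverse dotp_commute)

lemma inv_form_nonneg: "x \<in> vecs S \<Longrightarrow> 0 \<le> inv_form S M x"
  using mapp_inverse[of x] inv_form_apply[of "mapp S (minv S M) x"] posdef_nonneg[OF M(3)]
  by metis

text \<open>With \<open>z = M^-1 x\<close>, expanding the squared norm of \<open>x - l z\<close> and
  using \<open>l (z . z) \<le> z . x\<close> gives the bound without diagonalising
  \<open>M\<close>.\<close>

lemma inv_form_upper:
  assumes "x \<in> vecs S"
  shows "lambda_min S M * inv_form S M x \<le> dotp S x x"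
proof -
  define l where "l = lambda_min S M"
  have l: "l > 0" using lambda_min_posdef(1)[OF S M] by (simp add: l_def)
  define z where "z = mapp S (minv S M) x"
  have z: "z \<in> vecs S" "mapp S M z = x"
    using mapp_inverse[OF assms] by (auto simp: z_def)
  have "l * dotp S z z \<le> dotp S z x"
    using lambda_min_posdef(2)[OF S M z(1)] z by (simp add: l_def)
  then have "l * (l * dotp S z z) \<le> l * dotp S z x"
    using l by (intro mult_left_mono) auto
  moreover have "0 \<le> dotp S (\<lambda>i. x i - l * z i) (\<lambda>i. x i - l * z i)"
    by (rule dotp_self_nonneg)
  ultimately have "l * dotp S z x \<le> dotp S x x"
    by (simp add: dotp_simps dotp_commute[of S x z] algebra_simps)
  then show ?thesis
    by (simp add: inv_form_def l_def z_def dotp_commute)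
qed

text \<open>With \<open>y\<close> the projection of \<open>M v\<close> onto \<open>Ker P\<close> and \<open>z = M\<^sup>-\<^sup>1 y\<close>, one has \<open>v \<bullet> M v = v \<bullet> M z\<close>,
  so positivity of the form at \<open>v - z\<close> yields \<open>v \<bullet> M v \<le> z \<bullet> M z\<close>.\<close>

lemma energy_le_of_kernel:
  assumes U: "finite U" and P: "P \<in> mats U S" "mmul S P (transp P) = idm U"
    and v: "v \<in> vecs S" "mapp S P v = zerov" and c: "0 \<le> c"
    and bound: "\<And>y. y \<in> kernel_of S P \<Longrightarrow> inv_form S M y \<le> c * dotp S y y"
  shows "dotp S v (mapp S M v) \<le> c * dotp S (mapp S M v) (mapp S M v)"
proof -
  define x where "x = mapp S M v"
  define u where "u = mapp U (transp P) (mapp S P x)"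
  define y where "y = (\<lambda>i. x i - u i)"
  define z where "z = mapp S (minv S M) y"
  have x: "x \<in> vecs S" unfolding x_def by (rule mapp_vecs[OF M(1)])
  have u: "u \<in> vecs S" unfolding u_def by (rule mapp_vecs[OF mats_transp[OF P(1)]])
  have y: "y \<in> vecs S" unfolding y_def by (rule vecs_diff[OF x u])
  have z: "z \<in> vecs S" "mapp S M z = y"
    using mapp_inverse[OF y] by (auto simp: z_def)
  have "mapp S P u = mapp S P x"
    unfolding u_def by (rule mapp_right_inverse[OF P(2) U mapp_vecs[OF P(1)]])
  then have Py: "mapp S P y = zerov"
    by (simp add: y_def mapp_diff zerov_def)
  \<comment> \<open>\<open>u\<close> lies in the image of \<open>P^T\<close>, which is orthogonal to
    \<open>Ker P\<close>.\<close>
  have ort: "dotp S w u = 0" if "mapp S P w = zerov" for w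
    using that by (simp add: u_def dotp_mapp[of S w] dotp_zerov_left)
  have vy: "dotp S v y = dotp S v x"
    by (simp add: y_def dotp_simps ort[OF v(2)])
  have "dotp S x x = dotp S y y + dotp S u u"
    using ort[OF Py] by (simp add: y_def dotp_simps dotp_commute)
  then have yx: "dotp S y y \<le> dotp S x x"
    using dotp_self_nonneg[of S u] by simp
  have "0 \<le> dotp S (\<lambda>i. v i - z i) (mapp S M (\<lambda>i. v i - z i))"
    by (rule posdef_nonneg[OF M(3) vecs_diff[OF v(1) z(1)]])
  also have "\<dots> = dotp S v x - dotp S v y - dotp S z x + dotp S z y"
    by (simp add: mapp_diff dotp_simps z flip: x_def)
  also have "dotp S z x = dotp S v y"
    unfolding x_def dotp_mapp using M(2) z by (simp add: dotp_commute)
  finally have "dotp S v x \<le> dotp S z y"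
    using vy by simp
  also have "\<dots> = inv_form S M y"
    by (simp add: inv_form_def z_def dotp_commute)
  also have "\<dots> \<le> c * dotp S y y"
    using y Py by (intro bound) (simp add: kernel_of_def)
  also have "\<dots> \<le> c * dotp S x x"
    using yx c by (rule mult_left_mono)
  finally show ?thesis by (simp add: x_def)
qed

text \<open>A real \<open>INF\<close> bounds its members only when the family is bounded below; here
  0 is a lower bound. Squaring then removes the roots.\<close>

lemma inv_form_ge_of_INF:
  assumes "C > 0" "h \<ge> 0"
    and le: "1 / (C * sqrt (lambda_min S M)) * h
      \<le> (INF x\<in>X - {zerov}. sqrt (inv_form S M x) / L2_set x S)"
    and x: "x \<in> X" "x \<in> vecs S" "x \<noteq> zerov" and X: "X \<subseteq> vecs S"
  shows "inverse (C\<^sup>2) * h\<^sup>2 \<le> lambda_min S M * (inv_form S M x / (L2_set x S)\<^sup>2)"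
proof -
  define l where "l = lambda_min S M"
  have l: "l > 0" using lambda_min_posdef(1)[OF S M] by (simp add: l_def)
  have "bdd_below ((\<lambda>x. sqrt (inv_form S M x) / L2_set x S) ` (X - {zerov}))"
    using X by (intro bdd_belowI[of _ 0]) (auto intro!: divide_nonneg_nonneg inv_form_nonneg)
  then have "(INF x\<in>X - {zerov}. sqrt (inv_form S M x) / L2_set x S) \<le> sqrt (inv_form S M x) / L2_set x S"
    using x by (intro cINF_lower) auto
  with le have "1 / (C * sqrt l) * h \<le> sqrt (inv_form S M x) / L2_set x S"
    by (simp add: l_def)
  then have "(1 / (C * sqrt l) * h)\<^sup>2 \<le> (sqrt (inv_form S M x) / L2_set x S)\<^sup>2"
    using assms l by (intro power_mono) auto
  also have "(1 / (C * sqrt l) * h)\<^sup>2 = inverse (C\<^sup>2) * h\<^sup>2 / l"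
    using l by (simp add: power_mult_distrib power_divide field_simps)
  also have "(sqrt (inv_form S M x) / L2_set x S)\<^sup>2 = inv_form S M x / (L2_set x S)\<^sup>2"
    using inv_form_nonneg[OF x(2)] by (simp add: power_divide)
  finally show ?thesis
    using l by (simp add: pos_divide_le_eq mult.commute flip: l_def)
qed

text \<open>A real \<open>SUP\<close> bounds its members only when the family is bounded above,
  which \<open>inv_form_upper\<close> supplies. The zero vector lies outside the family and is
  treated apart.\<close>

lemma inv_form_le_of_SUP:
  assumes le: "(SUP x\<in>X - {zerov}. sqrt (inv_form S M x) / L2_set x S)
      \<le> C / sqrt (lambda_min S M) * h"
    and x: "x \<in> X" and X: "X \<subseteq> vecs S"
  shows "inv_form S M x \<le> C\<^sup>2 * h\<^sup>2 / lambda_min S M * dotp S x x"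
proof (cases "x = zerov")
  case True
  then show ?thesis by (simp add: inv_form_def dotp_zerov_left)
next
  case False
  define l where "l = lambda_min S M"
  have l: "l > 0" using lambda_min_posdef(1)[OF S M] by (simp add: l_def)
  have pos: "0 < dotp S y y" if "y \<in> X - {zerov}" for y
    using that X S by (intro dotp_self_pos) auto
  have "sqrt (inv_form S M y) / L2_set y S \<le> sqrt (1 / l)" if y: "y \<in> X - {zerov}" for y
  proof -
    have "l * inv_form S M y \<le> dotp S y y"
      unfolding l_def using y X by (intro inv_form_upper) auto
    with l pos[OF y] have "inv_form S M y / dotp S y y \<le> 1 / l"
      by (simp add: field_simps)
    then show ?thesis
      by (simp add: L2_set_dotp flip: real_sqrt_divide)
  qed
  then have "bdd_above ((\<lambda>x. sqrt (inv_form S M x) / L2_set x S) ` (X - {zerov}))"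
    by (intro bdd_aboveI[of _ "sqrt (1 / l)"]) auto
  then have "sqrt (inv_form S M x) / L2_set x S \<le> (SUP x\<in>X - {zerov}. sqrt (inv_form S M x) / L2_set x S)"
    using x False by (intro cSUP_upper) auto
  with le have "sqrt (inv_form S M x) / L2_set x S \<le> C / sqrt l * h"
    by (simp add: l_def)
  moreover have xv: "x \<in> vecs S" using x X by auto
  ultimately have "(sqrt (inv_form S M x) / L2_set x S)\<^sup>2 \<le> (C / sqrt l * h)\<^sup>2"
    by (intro power_mono) (auto intro!: divide_nonneg_nonneg inv_form_nonneg)
  also have "(C / sqrt l * h)\<^sup>2 = C\<^sup>2 * h\<^sup>2 / l"
    using l by (simp add: power_mult_distrib power_divide)
  also have "(sqrt (inv_form S M x) / L2_set x S)\<^sup>2 = inv_form S M x / dotp S x x"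
    using inv_form_nonneg[OF xv] dotp_self_nonneg[of S x] by (simp add: power_divide L2_set_dotp)
  finally show ?thesis
    using pos[of x] x False by (simp add: pos_divide_le_eq flip: l_def)
qed

end

section \<open>Assembling the two-sided bounds\<close>

theorem theorem2p5:
  fixes C\<^sub>d :: real
  assumes "C\<^sub>d \<ge> 1"
  shows "\<exists>C\<ge>1. \<forall>(q::nat) (I::tuple set) (J::nat \<Rightarrow> tuple set) (p::nat \<Rightarrow> tmat) (W::nat \<Rightarrow> tmat)
      (A::tmat) (H::real).
    index_tree q I \<longrightarrow> pi_family q I p \<longrightarrow> J_family q I J \<longrightarrow> W_family q I J p W \<longrightarrow>
    A \<in> mats I I \<longrightarrow> symmetric_mat A \<longrightarrow> posdef_mat I A \<longrightarrow>
    0 < H \<longrightarrow> H < 1 \<longrightarrow>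
    (\<forall>k\<in>{1..q}.
       1 / (C\<^sub>d * sqrt (lambda_min I A)) * H ^ k
       \<le> (INF x\<in>image_of (level I k) (pi_from_q q I p k) - {zerov}.
            sqrt (dotp I x (mapp I (minv I A) x)) / L2_set x I)) \<longrightarrow>
    (\<forall>k\<in>{1..<q}.
       (SUP x\<in>kernel_of I (pi_to_q q I p k) - {zerov}.
            sqrt (dotp I x (mapp I (minv I A) x)) / L2_set x I)
       \<le> C\<^sub>d / sqrt (lambda_min I A) * H ^ k) \<longrightarrow>
    (\<forall>v\<in>V_space q I J p W A 1. v \<noteq> zerov \<longrightarrow>
       inverse C * H ^ 2 \<le> lambda_min I A * (dotp I v (mapp I A v) / (L2_set (mapp I A v) I)\<^sup>2) \<and>
       lambda_min I A * (dotp I v (mapp I A v) / (L2_set (mapp I A v) I)\<^sup>2) \<le> C) \<and>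
    (\<forall>k\<in>{2..q}. \<forall>v\<in>W_space q I J p W A k. v \<noteq> zerov \<longrightarrow>
       inverse C * H ^ (2 * k) \<le> lambda_min I A * (dotp I v (mapp I A v) / (L2_set (mapp I A v) I)\<^sup>2) \<and>
       lambda_min I A * (dotp I v (mapp I A v) / (L2_set (mapp I A v) I)\<^sup>2) \<le> C * H ^ (2 * k - 2))"
proof (intro exI[of _ "C\<^sub>d\<^sup>2"] conjI allI impI ballI)
  show "1 \<le> C\<^sub>d\<^sup>2" using assms by simp
next
  fix q I J p W A and H :: real
  assume hyps: "index_tree q I" "pi_family q I p" "J_family q I J" "W_family q I J p W"
    "A \<in> mats I I" "symmetric_mat A" "posdef_mat I A" and H: "0 < H" "H < 1"
    and lower: "\<forall>k\<in>{1..q}.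
       1 / (C\<^sub>d * sqrt (lambda_min I A)) * H ^ k
       \<le> (INF x\<in>image_of (level I k) (pi_from_q q I p k) - {zerov}.
            sqrt (dotp I x (mapp I (minv I A) x)) / L2_set x I)"
    and upper: "\<forall>k\<in>{1..<q}.
       (SUP x\<in>kernel_of I (pi_to_q q I p k) - {zerov}.
            sqrt (dotp I x (mapp I (minv I A) x)) / L2_set x I)
       \<le> C\<^sub>d / sqrt (lambda_min I A) * H ^ k"
  then interpret gamblet q I J p W A
    by unfold_locales (auto simp: symmetric_mat_def)
  have I: "finite I" "I \<noteq> {}" and q: "q \<ge> 1" using tree by (auto simp: index_tree_def)
  note inv = I A
  define l where "l = lambda_min I A"
  have l: "l > 0" using lambda_min_posdef(1)[OF inv] by (simp add: l_def)
  have form: "dotp I v (mapp I A v) = inv_form I A (mapp I A v)" if "v \<in> vecs I" for v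
    using inv_form_apply[OF inv that] by simp
  have image_vecs: "image_of (level I k) (pi_from_q q I p k) \<subseteq> vecs I" if "k \<in> {1..q}" for k
    using Pi_isometry[OF that] by (auto simp: image_of_def pi_from_q_def intro: mapp_vecs[OF mats_transp])
  have nonzero: "mapp I A v \<noteq> zerov" if "v \<in> vecs I" "v \<noteq> zerov" for v
    using posdef_inj[OF A(3)] that by blast
  \<comment> \<open>Stated for all levels at once: used at level 1 for \<open>V_space\<close>, and
    at level \<open>k\<close> for \<open>W_space\<close>, which is contained in
    \<open>V_space\<close>.\<close>
  have low: "inverse (C\<^sub>d\<^sup>2) * H ^ (2 * k)
      \<le> l * (dotp I v (mapp I A v) / (L2_set (mapp I A v) I)\<^sup>2)"
    if k: "k \<in> {1..q}" and v: "v \<in> V_space q I J p W A k" "v \<noteq> zerov" for k v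
  proof -
    have "inverse (C\<^sub>d\<^sup>2) * (H ^ k)\<^sup>2 \<le> lambda_min I A * (inv_form I A (mapp I A v) / (L2_set (mapp I A v) I)\<^sup>2)"
    proof (rule inv_form_ge_of_INF[OF inv _ _ _ V_space_properties(2)[OF k v(1)] _ _ image_vecs[OF k]])
      show "1 / (C\<^sub>d * sqrt (lambda_min I A)) * H ^ k
          \<le> (INF x\<in>image_of (level I k) (pi_from_q q I p k) - {zerov}.
              sqrt (inv_form I A x) / L2_set x I)"
        using lower k by (simp add: inv_form_def)
    qed (use assms H v V_space_properties[OF k v(1)] image_vecs[OF k] nonzero in auto)
    then show ?thesis
      using form V_space_properties(1)[OF k v(1)]
      by (simp add: l_def power_mult[symmetric] mult.commute[of 2])
  qed
  have up: "l * (dotp I v (mapp I A v) / (L2_set (mapp I A v) I)\<^sup>2) \<le> c"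
    if "v \<in> vecs I" "v \<noteq> zerov"
      and le: "dotp I v (mapp I A v) \<le> c / l * dotp I (mapp I A v) (mapp I A v)" for v c
  proof -
    have "0 < dotp I (mapp I A v) (mapp I A v)"
      using that nonzero I A by (intro dotp_self_pos mapp_vecs[OF A(1)]) auto
    with le l show ?thesis
      by (simp add: L2_set_dotp field_simps)
  qed
  {
    fix v assume v: "v \<in> V_space q I J p W A 1" "v \<noteq> zerov"
    have one: "1 \<in> {1..q}" using q by simp
    have vv: "v \<in> vecs I" using V_space_properties[OF one v(1)] by simp
    show "inverse (C\<^sub>d\<^sup>2) * H ^ 2 \<le> lambda_min I A * (dotp I v (mapp I A v) / (L2_set (mapp I A v) I)\<^sup>2)"
      using low[OF one v] by (simp add: l_def)
    have "lambda_min I A * (dotp I v (mapp I A v) / (L2_set (mapp I A v) I)\<^sup>2) \<le> 1"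
      using up[OF vv v(2), of 1] inv_form_upper[OF inv mapp_vecs[OF A(1)], of I v] form[OF vv] l
      by (simp add: l_def field_simps)
    also have "1 \<le> C\<^sub>d\<^sup>2" using assms by simp
    finally show "lambda_min I A * (dotp I v (mapp I A v) / (L2_set (mapp I A v) I)\<^sup>2) \<le> C\<^sub>d\<^sup>2" .
  }
  fix k v assume k: "k \<in> {2..q}" and v: "v \<in> W_space q I J p W A k" "v \<noteq> zerov"
  \<comment> \<open>Hypothesis (i) is applied at \<open>k\<close> and (ii) at \<open>k - 1\<close>,
    whence the exponents \<open>2 * k\<close> and \<open>2 * k - 2\<close>; \<open>2 \<le> k\<close>
    puts \<open>k - 1\<close> in the range of (ii).\<close>
  have k1: "k \<in> {1..q}" and k2: "k - 1 \<in> {1..<q}" and k3: "k - 1 \<in> {1..q}" using k by auto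
  have vV: "v \<in> V_space q I J p W A k" using W_space_subset v by auto
  have vv: "v \<in> vecs I" using V_space_properties[OF k1 vV] by simp
  show "inverse (C\<^sub>d\<^sup>2) * H ^ (2 * k) \<le> lambda_min I A * (dotp I v (mapp I A v) / (L2_set (mapp I A v) I)\<^sup>2)"
    using low[OF k1 vV v(2)] by (simp add: l_def)
  have "dotp I v (mapp I A v)
      \<le> C\<^sub>d\<^sup>2 * (H ^ (k - 1))\<^sup>2 / l * dotp I (mapp I A v) (mapp I A v)"
  proof (rule energy_le_of_kernel[OF inv finite_level _ _ vv W_space_kernel[OF k v(1)]])
    fix y assume y: "y \<in> kernel_of I (pi_to_q q I p (k - 1))"
    have le: "(SUP x\<in>kernel_of I (pi_to_q q I p (k - 1)) - {zerov}.
          sqrt (inv_form I A x) / L2_set x I) \<le> C\<^sub>d / sqrt (lambda_min I A) * H ^ (k - 1)"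
      using upper k2 by (simp only: inv_form_def)
    show "inv_form I A y \<le> C\<^sub>d\<^sup>2 * (H ^ (k - 1))\<^sup>2 / l * dotp I y y"
      using inv_form_le_of_SUP[OF inv le y] by (auto simp: kernel_of_def l_def)
  qed (use l Pi_isometry[OF k3] in auto)
  also have "(H ^ (k - 1))\<^sup>2 = H ^ (2 * k - 2)"
    using power_mult[of H "k - 1" 2] by (simp add: diff_mult_distrib mult.commute[of k 2])
  finally show "lambda_min I A * (dotp I v (mapp I A v) / (L2_set (mapp I A v) I)\<^sup>2) \<le> C\<^sub>d\<^sup>2 * H ^ (2 * k - 2)"
    using up[OF vv v(2)] by (simp add: l_def)
qed

end
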